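(* Let $A$ be an infinite set of nonnegative integers, let $d\ge 0$ be an integer and let $\lambda_0,\dots,\lambda_d$ be integers with $\sum_{i=0}^{d}|\lambda_i|>0$ and $\sum_{i=0}^{d}\lambda_i=0$; write $\underline{\lambda}=(\lambda_0,\dots,\lambda_d)$. Then \[ \limsup_{n \to \infty}\left|\sum_{i=0}^{d}\lambda_{i}R_{A}(n - i)\right| \ge \limsup_{n \to \infty}\frac{\sqrt{2}}{e^{2}\sum_{i=0}^{d}|\lambda_{i}|} \frac{B(A, \underline{\lambda}, n)}{\sqrt{n}}. \]
   Context: For a set $A$ of nonnegative integers and an integer $n$, $R_A(n)$ denotes the number of ordered pairs $(a,a')\in A\times A$ with $a+a'=n$ (so $R_A(n)=0$ for $n<0$). $\chi_A$ is the characteristic function of $A$ on the integers ($\chi_A(m)=0$ for $m<0$). For $\underline{\lambda}=(\lambda_0,\dots,\lambda_d)$ define $B(A,\underline{\lambda},n)=\#\{m\in\mathbb{Z}_{\ge 0}: m\le n,\ \sum_{i=0}^{d}\lambda_i\chi_A(m-i)\neq 0\}$. Limsups may equal $+\infty$. *)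

theory Defs
  imports "HOL-Analysis.Analysis"
begin

text \<open>
  The arguments below are shifted to \<open>n - i\<close> with \<open>i\<close> up to \<open>d\<close>, which may be negative;
  hence the argument type \<^typ>\<open>int\<close>, which avoids truncated subtraction on \<^typ>\<open>nat\<close>.
\<close>

definition rep_count :: "nat set \<Rightarrow> int \<Rightarrow> nat" where
  "rep_count A n = card {(a, a') \<in> A \<times> A. int a + int a' = n}"

definition char_fun :: "nat set \<Rightarrow> int \<Rightarrow> int" where
  "char_fun A m = indicator (int ` A) m"

text \<open>
  A tuple \<open>(\<lambda>\<^sub>0, \<dots>, \<lambda>\<^sub>d)\<close> is given by \<open>d\<close> and a function \<open>l\<close> of which
  only the values at \<open>0, \<dots>, d\<close> are used.
\<close>

definition B_count :: "nat set \<Rightarrow> nat \<Rightarrow> (nat \<Rightarrow> int) \<Rightarrow> nat \<Rightarrow> nat" where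
  "B_count A d l n =
     card {m :: nat. m \<le> n \<and> (\<Sum>i=0..d. l i * char_fun A (int m - int i)) \<noteq> 0}"

end

theory Submission
  imports Defs
begin

text \<open>
  Put \<open>P z = (\<Sum>i\<le>d. \<lambda>\<^sub>i z\<^sup>i)\<close>, \<open>F z = (\<Sum>a\<in>A. z\<^sup>a)\<close> and \<open>S = (\<Sum>i\<le>d. \<bar>\<lambda>\<^sub>i\<bar>)\<close>.  The numbers counted by \<open>B\<close>
  are the exponents of the nonzero (integer) coefficients of \<open>P F\<close>, and the combinations of the
  \<open>R\<^sub>A(n - i)\<close> are the coefficients of \<open>P F\<^sup>2\<close>; suppose the latter are eventually at most \<open>K\<close> in
  absolute value.  On a circle of radius \<open>r < 1\<close> we have \<open>\<bar>P F\<bar>\<^sup>2 \<le> S \<bar>P F\<^sup>2\<bar> \<le> S (t + \<bar>P F\<^sup>2\<bar>\<^sup>2 / t) / 2\<close>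
  for every \<open>t > 0\<close>, so by Parseval \<open>r\<^bsup>2N\<^esup> B(N) \<le> S (t + (C + K\<^sup>2 / (1 - r\<^sup>2)) / t) / 2\<close> with a
  constant \<open>C\<close>.  Taking \<open>r\<^sup>2 = 1 - 1 / (2 N)\<close>, so that \<open>r\<^bsup>2N\<^esup> \<ge> 1 / 2\<close> by Bernoulli's inequality, and
  \<open>t = 2 K \<surd>N\<close> gives \<open>B(N) \<le> 4 S K \<surd>N\<close> for large \<open>N\<close>, and \<open>4 \<surd>2 \<le> e\<^sup>2\<close>.
\<close>

section \<open>Parseval's identity, from trigonometric polynomials to power series on
  circles\<close>

text \<open>Expanding the square gives a double sum of cosines of \<open>(n - m) * t\<close>; over a
  full period only the diagonal terms survive.\<close>

lemma has_integral_norm_trig_poly_squared: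
  fixes c :: "nat \<Rightarrow> real"
  shows "((\<lambda>t. (norm (\<Sum>n<M. of_real (c n) * cis (real n * t)))\<^sup>2) has_integral
          2 * pi * (\<Sum>n<M. (c n)\<^sup>2)) {-pi..pi}"
proof -
  have eq: "(norm (\<Sum>n<M. of_real (c n) * cis (real n * t)))\<^sup>2 =
      (\<Sum>n<M. \<Sum>m<M. c n * c m * cos (real_of_int (int n - int m) * t))" for t
  proof -
    have "(norm (\<Sum>n<M. of_real (c n) * cis (real n * t)))\<^sup>2 =
        (\<Sum>n<M. c n * cos (real n * t))\<^sup>2 + (\<Sum>n<M. c n * sin (real n * t))\<^sup>2"
      by (simp add: cmod_power2)
    also have "\<dots> = (\<Sum>n<M. \<Sum>m<M. c n * c m * cos (real_of_int (int n - int m) * t))"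
      by (simp add: power2_eq_square sum_product cos_diff left_diff_distrib algebra_simps
          flip: sum.distrib)
    finally show ?thesis .
  qed
  have "((\<lambda>t. \<Sum>n<M. \<Sum>m<M. c n * c m * cos (real_of_int (int n - int m) * t)) has_integral
      (\<Sum>n<M. \<Sum>m<M. c n * c m * (if int n - int m = 0 then 2 * pi else 0))) {-pi..pi}"
    by (intro has_integral_sum has_integral_mult_right has_integral_cos_nx) auto
  also have "(\<Sum>n<M. \<Sum>m<M. c n * c m * (if int n - int m = 0 then 2 * pi else 0)) =
      (\<Sum>n<M. c n * c n * (2 * pi))"
    by (simp add: if_distrib cong: if_cong)
  also have "\<dots> = 2 * pi * (\<Sum>n<M. (c n)\<^sup>2)"
    by (simp add: sum_distrib_left power2_eq_square mult_ac)
  finally show ?thesis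
    by (simp add: eq)
qed

text \<open>The partial sums converge uniformly by the Weierstrass M-test, so the polynomial
  identity passes to the limit; convergence of the integrals also yields summability of the
  squares.\<close>

lemma has_integral_norm_trig_series_squared:
  fixes c :: "nat \<Rightarrow> real"
  assumes "summable (\<lambda>n. \<bar>c n\<bar>)"
  shows "summable (\<lambda>n. (c n)\<^sup>2)"
    and "((\<lambda>t. (norm (\<Sum>n. of_real (c n) * cis (real n * t)))\<^sup>2) has_integral
          2 * pi * (\<Sum>n. (c n)\<^sup>2)) {-pi..pi}"
proof -
  let ?f = "\<lambda>M t. \<Sum>n<M. of_real (c n) * cis (real n * t)"
  let ?g = "\<lambda>t. \<Sum>n. of_real (c n) * cis (real n * t)"
  have "uniform_limit {-pi..pi} ?f ?g sequentially"
    by (rule Weierstrass_m_test[where M = "\<lambda>n. \<bar>c n\<bar>"]) (use assms in \<open>auto simp: norm_mult\<close>)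
  then have lim: "uniform_limit {-pi..pi} (\<lambda>M t. norm (?f M t)) (\<lambda>t. norm (?g t)) sequentially"
    by (rule uniform_limit_norm)
  \<comment> \<open>Products of uniform limits converge uniformly once the limit functions are
    bounded; this bound allows squaring below.\<close>
  have "norm (?g t) \<le> (\<Sum>n. \<bar>c n\<bar>)" for t
  proof -
    have "norm (?g t) \<le> (\<Sum>n. norm (of_real (c n) * cis (real n * t)))"
      by (rule summable_norm) (use assms in \<open>simp add: norm_mult\<close>)
    then show ?thesis by (simp add: norm_mult)
  qed
  then have bdd: "bounded ((\<lambda>t. norm (?g t)) ` {-pi..pi})"
    by (auto simp: bounded_iff)
  have "uniform_limit {-pi..pi} (\<lambda>M t. (norm (?f M t))\<^sup>2) (\<lambda>t. (norm (?g t))\<^sup>2) sequentially"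
    unfolding power2_eq_square by (rule uniform_lim_mult[OF lim lim bdd bdd])
  then obtain I J where I: "\<And>M. ((\<lambda>t. (norm (?f M t))\<^sup>2) has_integral I M) {-pi..pi}"
    and J: "((\<lambda>t. (norm (?g t))\<^sup>2) has_integral J) {-pi..pi}" and IJ: "I \<longlonglongrightarrow> J"
    by (rule uniform_limit_integral) (auto intro!: continuous_intros simp: cis_conv_exp)
  have "I M = 2 * pi * (\<Sum>n<M. (c n)\<^sup>2)" for M
    using I has_integral_norm_trig_poly_squared by (rule has_integral_unique)
  then have "(\<lambda>M. 2 * pi * (\<Sum>n<M. (c n)\<^sup>2)) \<longlonglongrightarrow> J"
    using IJ by presburger
  then have "(\<lambda>M. (2 * pi * (\<Sum>n<M. (c n)\<^sup>2)) / (2 * pi)) \<longlonglongrightarrow> J / (2 * pi)"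
    by (intro tendsto_intros) auto
  then have sums: "(\<lambda>n. (c n)\<^sup>2) sums (J / (2 * pi))"
    by (simp add: sums_def)
  then show "summable (\<lambda>n. (c n)\<^sup>2)"
    by (rule sums_summable)
  from sums have "2 * pi * (\<Sum>n. (c n)\<^sup>2) = J"
    by (simp flip: sums_unique)
  with J show "((\<lambda>t. (norm (?g t))\<^sup>2) has_integral 2 * pi * (\<Sum>n. (c n)\<^sup>2)) {-pi..pi}"
    by simp
qed

text \<open>On the circle of radius \<open>r\<close> the series is a trigonometric series with
  coefficients \<open>c n\<close>, the radius being absorbed as \<open>r ^ n\<close>; since the
  coefficients are real, their real parts carry everything.\<close>

lemma Parseval_eval_fps:
  fixes F :: "complex fps" and r :: real
  assumes "\<And>n. fps_nth F n \<in> \<real>" and "0 \<le> r" and "ereal r < fps_conv_radius F"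
  shows "summable (\<lambda>n. (Re (fps_nth F n))\<^sup>2 * (r\<^sup>2) ^ n)"
    and "((\<lambda>t. (norm (eval_fps F (of_real r * cis t)))\<^sup>2) has_integral
          2 * pi * (\<Sum>n. (Re (fps_nth F n))\<^sup>2 * (r\<^sup>2) ^ n)) {-pi..pi}"
proof -
  define c where "c n = Re (fps_nth F n) * r ^ n" for n
  have Fc: "fps_nth F n * of_real r ^ n = of_real (c n)" for n
    using assms(1)[of n] by (simp add: c_def of_real_Re)
  have "summable (\<lambda>n. norm (fps_nth F n * of_real r ^ n))"
    by (rule norm_summable_fps) (use assms in simp)
  then have summ: "summable (\<lambda>n. \<bar>c n\<bar>)"
    by (simp add: Fc)
  have sq: "(c n)\<^sup>2 = (Re (fps_nth F n))\<^sup>2 * (r\<^sup>2) ^ n" for n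
    by (simp add: c_def power_mult_distrib mult.commute flip: power_mult)
  have "fps_nth F n * (of_real r * cis t) ^ n = of_real (c n) * cis (real n * t)" for n t
    by (simp add: power_mult_distrib Complex.DeMoivre flip: Fc)
  then have ev: "eval_fps F (of_real r * cis t) = (\<Sum>n. of_real (c n) * cis (real n * t))" for t
    by (simp add: eval_fps_def)
  show "summable (\<lambda>n. (Re (fps_nth F n))\<^sup>2 * (r\<^sup>2) ^ n)"
    using has_integral_norm_trig_series_squared(1)[OF summ] by (simp add: sq)
  show "((\<lambda>t. (norm (eval_fps F (of_real r * cis t)))\<^sup>2) has_integral
          2 * pi * (\<Sum>n. (Re (fps_nth F n))\<^sup>2 * (r\<^sup>2) ^ n)) {-pi..pi}"
    using has_integral_norm_trig_series_squared(2)[OF summ] by (simp add: sq ev)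
qed

section \<open>Comparing the coefficients of \<open>P * F\<close> and
  \<open>P * F ^ 2\<close>\<close>

text \<open>Parseval needs squared norms, but the pointwise bound for the square of
  \<open>norm (P F)\<close> is linear in \<open>w = norm (P F F)\<close>. The inequality
  \<open>(t - w)\<^sup>2 \<ge> 0\<close> trades \<open>w\<close> for its square; the free parameter
  \<open>t\<close> stands in for a Cauchy-Schwarz step.\<close>

lemma sum_Re_coeffs_squared_le:
  fixes P F :: "complex fps" and r S t :: real
  assumes P: "\<And>n. fps_nth P n \<in> \<real>" "ereal r < fps_conv_radius P"
    and F: "\<And>n. fps_nth F n \<in> \<real>" "ereal r < fps_conv_radius F"
    and r: "0 \<le> r" and S: "\<And>z. norm z = r \<Longrightarrow> norm (eval_fps P z) \<le> S" and t: "t > 0"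
  shows "(\<Sum>n. (Re (fps_nth (P * F) n))\<^sup>2 * (r\<^sup>2) ^ n) \<le>
         S * (t + (\<Sum>n. (Re (fps_nth (P * F ^ 2) n))\<^sup>2 * (r\<^sup>2) ^ n) / t) / 2"
proof -
  have rad: "ereal r < fps_conv_radius (G * H)"
    if "ereal r < fps_conv_radius G" "ereal r < fps_conv_radius H" for G H :: "complex fps"
    using that fps_conv_radius_mult[of G H] by (meson less_le_trans min_less_iff_conj)
  have real: "fps_nth (G * H) n \<in> \<real>"
    if "\<And>n. fps_nth G n \<in> \<real>" "\<And>n. fps_nth H n \<in> \<real>" for G H :: "complex fps" and n
    using that by (auto simp: fps_mult_nth intro!: sum_in_Reals Reals_mult)
  \<comment> \<open>The bound \<open>S\<close> dominates a norm at the point \<open>r\<close> of the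
    circle.\<close>
  have S0: "0 \<le> S"
    using order_trans[OF norm_ge_zero S[of "of_real r"]] r by simp
  define U V where "U = (\<Sum>n. (Re (fps_nth (P * F) n))\<^sup>2 * (r\<^sup>2) ^ n)"
    and "V = (\<Sum>n. (Re (fps_nth (P * F ^ 2) n))\<^sup>2 * (r\<^sup>2) ^ n)"
  have U: "((\<lambda>s. (norm (eval_fps (P * F) (of_real r * cis s)))\<^sup>2) has_integral 2 * pi * U) {-pi..pi}"
    unfolding U_def by (rule Parseval_eval_fps) (use assms in \<open>auto intro!: real rad\<close>)
  have V: "((\<lambda>s. (norm (eval_fps (P * F ^ 2) (of_real r * cis s)))\<^sup>2) has_integral 2 * pi * V) {-pi..pi}"
    unfolding V_def power2_eq_square[of F]
    by (rule Parseval_eval_fps) (use assms in \<open>auto intro!: real rad\<close>)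
  have pointwise: "(norm (eval_fps (P * F) z))\<^sup>2 \<le>
      S * (t + (norm (eval_fps (P * F ^ 2) z))\<^sup>2 / t) / 2" if z: "norm z = r" for z
  proof -
    define p f where "p = eval_fps P z" and "f = eval_fps F z"
    have PF: "eval_fps (P * F) z = p * f"
      unfolding p_def f_def by (rule eval_fps_mult) (use P F z in auto)
    have FF: "eval_fps (F * F) z = f * f"
      unfolding f_def by (rule eval_fps_mult) (use F z in auto)
    have PFF: "eval_fps (P * F ^ 2) z = p * (f * f)"
      unfolding p_def FF[symmetric] power2_eq_square
      by (rule eval_fps_mult) (use P F z rad[of F F] in auto)
    define w where "w = norm (p * (f * f))"
    have "(norm (p * f))\<^sup>2 = norm p * w"
      by (simp add: w_def norm_mult power2_eq_square)
    also have "\<dots> \<le> S * w"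
      using S[OF z] by (intro mult_right_mono) (auto simp: p_def w_def)
    also have "\<dots> \<le> S * ((t + w\<^sup>2 / t) / 2)"
    proof (rule mult_left_mono[OF _ S0])
      have "0 \<le> (t - w)\<^sup>2" by simp
      then show "w \<le> (t + w\<^sup>2 / t) / 2"
        using t by (simp add: field_simps power2_eq_square)
    qed
    finally show ?thesis
      by (simp add: PF PFF w_def)
  qed
  have const: "((\<lambda>s. t) has_integral 2 * pi * t) {-pi..pi}"
    using has_integral_const_real[of t "-pi" pi] by simp
  have "((\<lambda>s. S * (t + (norm (eval_fps (P * F ^ 2) (of_real r * cis s)))\<^sup>2 / t) / 2) has_integral
      S * (2 * pi * t + 2 * pi * V / t) / 2) {-pi..pi}"
    by (intro has_integral_mult_right has_integral_divide has_integral_add V const)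
  then have "2 * pi * U \<le> S * (2 * pi * t + 2 * pi * V / t) / 2"
    by (rule has_integral_le[OF U]) (rule pointwise, use r in \<open>simp add: norm_mult\<close>)
  also have "\<dots> = 2 * pi * (S * (t + V / t) / 2)"
    by (simp add: algebra_simps)
  finally show ?thesis
    by (simp add: U_def V_def)
qed

section \<open>Generating functions of the shifts and of \<open>A\<close>\<close>

text \<open>The polynomial \<open>P\<close> as a power series: multiplication by it forms the
  combination of shifts of a coefficient sequence.\<close>

definition shift_fps :: "nat \<Rightarrow> (nat \<Rightarrow> int) \<Rightarrow> complex fps" where
  "shift_fps d l = Abs_fps (\<lambda>i. if i \<le> d then of_int (l i) else 0)"

definition set_fps :: "nat set \<Rightarrow> complex fps" where
  "set_fps A = Abs_fps (\<lambda>n. of_int (char_fun A (int n)))"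

lemma char_fun_int: "char_fun A (int n) = (if n \<in> A then 1 else 0)"
  by (auto simp: char_fun_def indicator_def)

text \<open>The sum up to \<open>d\<close> and the convolution up to \<open>n\<close> agree: terms
  with \<open>i > n\<close> vanish because \<open>g\<close> is zero at negative arguments, terms
  with \<open>i > d\<close> because \<open>P\<close> has no such coefficients.\<close>

lemma fps_nth_shift_fps_mult:
  assumes "\<And>m. m < 0 \<Longrightarrow> g m = (0::int)" and "\<And>n. fps_nth G n = of_int (g (int n))"
  shows "fps_nth (shift_fps d l * G) n = of_int (\<Sum>i=0..d. l i * g (int n - int i))"
proof -
  have "(\<Sum>i=0..d. l i * g (int n - int i)) =
      (\<Sum>i=0..n. (if i \<le> d then l i else 0) * g (int (n - i)))"
    using assms(1) by (intro sum.mono_neutral_cong) (auto simp: of_nat_diff)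
  then show ?thesis
    by (auto simp: fps_mult_nth shift_fps_def assms(2) intro!: sum.cong)
qed

text \<open>A representation of \<open>n\<close> is determined by its first summand
  \<open>i\<close>, the other being \<open>n - i\<close>.\<close>

lemma fps_nth_set_fps_squared: "fps_nth (set_fps A ^ 2) n = of_int (int (rep_count A (int n)))"
proof -
  have mem: "n - a = b" if "int a + int b = int n" for a b
    using that by linarith
  have "fps_nth (set_fps A ^ 2) n = (\<Sum>i=0..n. if i \<in> A \<and> n - i \<in> A then 1 else 0)"
    by (auto simp: power2_eq_square fps_mult_nth set_fps_def char_fun_int intro!: sum.cong)
  also have "\<dots> = of_nat (card {i. i \<le> n \<and> i \<in> A \<and> n - i \<in> A})"
    by (simp add: sum.If_cases Int_def)
  also have "card {i. i \<le> n \<and> i \<in> A \<and> n - i \<in> A} = rep_count A (int n)"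
    unfolding rep_count_def
  proof (rule bij_betw_same_card)
    show "bij_betw (\<lambda>i. (i, n - i)) {i. i \<le> n \<and> i \<in> A \<and> n - i \<in> A}
        {(a, a') \<in> A \<times> A. int a + int a' = int n}"
      by (rule bij_betwI[where g = fst]) (use mem in auto)
  qed
  finally show ?thesis by simp
qed

lemma fps_nth_shift_fps_mult_set_fps:
  "fps_nth (shift_fps d l * set_fps A) n =
    of_int (\<Sum>i=0..d. l i * char_fun A (int n - int i))"
  by (rule fps_nth_shift_fps_mult) (auto simp: char_fun_def set_fps_def indicator_def)

lemma fps_nth_shift_fps_mult_set_fps_squared:
  "fps_nth (shift_fps d l * set_fps A ^ 2) n =
    of_int (\<Sum>i=0..d. l i * int (rep_count A (int n - int i)))"
proof (rule fps_nth_shift_fps_mult)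
  fix m :: int assume "m < 0"
  then have "{(a, a') \<in> A \<times> A. int a + int a' = m} = {}" by auto
  then show "int (rep_count A m) = 0" unfolding rep_count_def by (simp only: card.empty of_nat_0)
qed (rule fps_nth_set_fps_squared)

lemma fps_conv_radius_ge_1:
  fixes F :: "complex fps"
  assumes "\<And>n. norm (fps_nth F n) \<le> M"
  shows "fps_conv_radius F \<ge> 1"
  unfolding fps_conv_radius_def
proof (rule conv_radius_geI_ex)
  fix r :: real assume r: "0 < r" "ereal r < 1"
  have "summable (\<lambda>n. fps_nth F n * of_real r ^ n)"
  proof (rule summable_comparison_test')
    show "summable (\<lambda>n. M * r ^ n)"
      using r by (intro summable_mult summable_geometric) auto
    show "norm (fps_nth F n * of_real r ^ n) \<le> M * r ^ n" for n
      using assms[of n] r by (auto simp: norm_mult norm_power intro!: mult_right_mono)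
  qed
  then show "\<exists>z. norm z = r \<and> summable (\<lambda>n. fps_nth F n * z ^ n)"
    using r by (intro exI[of _ "of_real r"]) auto
qed

lemma norm_eval_shift_fps_le:
  assumes "norm z \<le> 1"
  shows "norm (eval_fps (shift_fps d l) z) \<le> real_of_int (\<Sum>i=0..d. \<bar>l i\<bar>)"
proof -
  have "eval_fps (shift_fps d l) z = (\<Sum>i=0..d. of_int (l i) * z ^ i)"
    unfolding eval_fps_def by (subst suminf_finite[of "{0..d}"]) (auto simp: shift_fps_def)
  also have "norm \<dots> \<le> (\<Sum>i=0..d. \<bar>real_of_int (l i)\<bar>)"
  proof (rule sum_norm_le)
    fix i
    show "norm (of_int (l i) * z ^ i) \<le> \<bar>real_of_int (l i)\<bar>"
      using assms by (simp add: norm_mult norm_power power_le_one mult_left_le)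
  qed
  finally show ?thesis by simp
qed

section \<open>Weighted sums of squares and the growth of \<open>B_count\<close>\<close>

text \<open>The finitely many early terms contribute at most the sum of their squares, which serves
  as \<open>C\<close> for all \<open>x\<close> at once; a geometric series majorises the
  rest.\<close>

lemma suminf_eventually_bounded_squares_le:
  fixes D :: "nat \<Rightarrow> real" and K :: real
  assumes "eventually (\<lambda>n. \<bar>D n\<bar> \<le> K) sequentially"
  obtains C where "\<And>x. 0 \<le> x \<Longrightarrow> x < 1 \<Longrightarrow> (\<Sum>n. (D n)\<^sup>2 * x ^ n) \<le> C + K\<^sup>2 / (1 - x)"
proof -
  obtain n0 where n0: "\<And>n. n \<ge> n0 \<Longrightarrow> \<bar>D n\<bar> \<le> K"
    using assms by (auto simp: eventually_sequentially)
  show thesis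
  proof (rule that)
    fix x :: real assume x: "0 \<le> x" "x < 1"
    define g where "g n = (if n \<in> {..<n0} then (D n)\<^sup>2 else 0) + K\<^sup>2 * x ^ n" for n
    have g: "g sums ((\<Sum>n<n0. (D n)\<^sup>2) + K\<^sup>2 * (1 / (1 - x)))"
      unfolding g_def using x by (intro sums_add sums_If_finite_set sums_mult geometric_sums) auto
    have le: "(D n)\<^sup>2 * x ^ n \<le> g n" for n
    proof (cases "n < n0")
      case True
      have "(D n)\<^sup>2 * x ^ n \<le> (D n)\<^sup>2" using x by (intro mult_left_le power_le_one) auto
      moreover have "0 \<le> K\<^sup>2 * x ^ n" using x by simp
      ultimately show ?thesis using True by (simp add: g_def)
    next
      case False
      then have "(D n)\<^sup>2 \<le> K\<^sup>2" using n0[of n] by (intro abs_le_square_iff[THEN iffD1]) auto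
      then show ?thesis using False x by (simp add: g_def mult_right_mono)
    qed
    have "summable (\<lambda>n. (D n)\<^sup>2 * x ^ n)"
      by (rule summable_comparison_test'[OF sums_summable[OF g]]) (use le x in auto)
    then have "(\<Sum>n. (D n)\<^sup>2 * x ^ n) \<le> suminf g"
      by (intro suminf_le le sums_summable[OF g])
    then show "(\<Sum>n. (D n)\<^sup>2 * x ^ n) \<le> (\<Sum>n<n0. (D n)\<^sup>2) + K\<^sup>2 / (1 - x)"
      using g by (simp add: sums_iff)
  qed
qed

text \<open>A nonzero integer has square at least 1, and \<open>x ^ n \<ge> x ^ N\<close> for
  \<open>n \<le> N\<close>.\<close>

lemma B_count_le:
  fixes x :: real
  assumes x: "0 \<le> x" "x \<le> 1"
    and summ: "summable (\<lambda>n. (real_of_int (\<Sum>i=0..d. l i * char_fun A (int n - int i)))\<^sup>2 * x ^ n)"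
  shows "x ^ N * real (B_count A d l N) \<le>
    (\<Sum>n. (real_of_int (\<Sum>i=0..d. l i * char_fun A (int n - int i)))\<^sup>2 * x ^ n)"
proof -
  define u where "u n = (\<Sum>i=0..d. l i * char_fun A (int n - int i))" for n
  have "x ^ N * real (B_count A d l N) = (\<Sum>n | n \<le> N \<and> u n \<noteq> 0. x ^ N)"
    by (simp add: B_count_def u_def)
  also have "\<dots> \<le> (\<Sum>n | n \<le> N \<and> u n \<noteq> 0. (real_of_int (u n))\<^sup>2 * x ^ n)"
  proof (rule sum_mono, clarify)
    fix n assume n: "n \<le> N" "u n \<noteq> 0"
    then have "1 \<le> \<bar>u n\<bar>" by simp
    then have "1\<^sup>2 \<le> (u n)\<^sup>2" by (subst abs_le_square_iff[symmetric]) simp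
    then have "1 \<le> (real_of_int (u n))\<^sup>2" by (simp flip: of_int_power)
    then have "1 * x ^ N \<le> (real_of_int (u n))\<^sup>2 * x ^ n"
      using n x by (intro mult_mono power_decreasing) auto
    then show "x ^ N \<le> (real_of_int (u n))\<^sup>2 * x ^ n" by simp
  qed
  also have "\<dots> \<le> (\<Sum>n. (real_of_int (u n))\<^sup>2 * x ^ n)"
    using summ x by (intro sum_le_suminf) (auto simp: u_def)
  finally show ?thesis by (simp add: u_def)
qed

lemma eventually_B_count_le:
  fixes K :: real
  assumes K: "K > 0"
    and bound: "eventually (\<lambda>n. \<bar>real_of_int (\<Sum>i=0..d. l i * int (rep_count A (int n - int i)))\<bar> \<le> K)
      sequentially"
  shows "eventually (\<lambda>N. real (B_count A d l N) \<le>
    4 * real_of_int (\<Sum>i=0..d. \<bar>l i\<bar>) * K * sqrt (real N)) sequentially"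
proof -
  define u where "u n = real_of_int (\<Sum>i=0..d. l i * char_fun A (int n - int i))" for n
  define D where "D n = real_of_int (\<Sum>i=0..d. l i * int (rep_count A (int n - int i)))" for n
  define S where "S = real_of_int (\<Sum>i=0..d. \<bar>l i\<bar>)"
  let ?P = "shift_fps d l" and ?F = "set_fps A"
  have radP: "fps_conv_radius ?P \<ge> 1"
  proof (rule fps_conv_radius_ge_1)
    show "norm (fps_nth ?P n) \<le> (\<Sum>i=0..d. \<bar>real_of_int (l i)\<bar>)" for n
      by (auto simp: shift_fps_def intro!: member_le_sum sum_nonneg)
  qed
  have radF: "fps_conv_radius ?F \<ge> 1"
    by (rule fps_conv_radius_ge_1[where M = 1]) (auto simp: set_fps_def char_fun_int)
  have realP: "fps_nth ?P n \<in> \<real>" and realF: "fps_nth ?F n \<in> \<real>" for n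
    by (auto simp: shift_fps_def set_fps_def)
  have Re_u: "Re (fps_nth (?P * ?F) n) = u n" for n
    unfolding fps_nth_shift_fps_mult_set_fps u_def complex_Re_of_int ..
  have Re_D: "Re (fps_nth (?P * ?F ^ 2) n) = D n" for n
    unfolding fps_nth_shift_fps_mult_set_fps_squared D_def complex_Re_of_int ..
  obtain C where C: "\<And>x. 0 \<le> x \<Longrightarrow> x < 1 \<Longrightarrow> (\<Sum>n. (D n)\<^sup>2 * x ^ n) \<le> C + K\<^sup>2 / (1 - x)"
    by (rule suminf_eventually_bounded_squares_le[OF bound[folded D_def]]) blast
  have S0: "S \<ge> 0" by (simp add: S_def sum_nonneg)
  \<comment> \<open>This makes \<open>C\<close> at most \<open>2 * K\<^sup>2 * N\<close>, the size
    of the other term \<open>K\<^sup>2 / (1 - x)\<close> for the \<open>x\<close> chosen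
    below.\<close>
  have "eventually (\<lambda>N. real N \<ge> C / (2 * K\<^sup>2)) sequentially"
    using filterlim_real_sequentially by (simp add: filterlim_at_top)
  then show ?thesis
    using eventually_gt_at_top[of 0]
  proof eventually_elim
    case (elim N)
    define x where "x = 1 - 1 / (2 * real N)"
    \<comment> \<open>Parseval weights the squared coefficients by powers of the squared radius,
      which is to be \<open>x\<close>.\<close>
    define r where "r = sqrt x"
    have x: "0 \<le> x" "x < 1" using elim by (auto simp: x_def field_simps)
    then have r: "0 \<le> r" "r < 1" "r\<^sup>2 = x" by (auto simp: r_def)
    have rad: "ereal r < fps_conv_radius ?P" "ereal r < fps_conv_radius ?F"
      using r radP radF by (auto intro: less_le_trans[of _ 1])
    define t where "t = 2 * K * sqrt (real N)"
    have t: "t > 0" using K elim by (simp add: t_def)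
    have "(\<Sum>n. (D n)\<^sup>2 * x ^ n) \<le> C + K\<^sup>2 / (1 - x)"
      using C x by blast
    \<comment> \<open>Each summand is at most \<open>2 * K\<^sup>2 * N\<close>, and
      \<open>t\<^sup>2\<close> is \<open>4 * K\<^sup>2 * N\<close>.\<close>
    also have "\<dots> \<le> t\<^sup>2"
      using elim K by (simp add: x_def t_def power_mult_distrib field_simps)
    finally have DT: "(\<Sum>n. (D n)\<^sup>2 * x ^ n) / t \<le> t"
      using t by (simp add: field_simps power2_eq_square)
    have "1 / 2 \<le> x ^ N"
      using Bernoulli_inequality[of "- 1 / (2 * real N)" N] elim by (simp add: x_def field_simps)
    then have "1 / 2 * real (B_count A d l N) \<le> x ^ N * real (B_count A d l N)"
      by (rule mult_right_mono) simp
    also have "\<dots> \<le> (\<Sum>n. (u n)\<^sup>2 * x ^ n)"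
      unfolding u_def
    proof (rule B_count_le)
      have "ereal r < fps_conv_radius (?P * ?F)"
        using rad fps_conv_radius_mult[of ?P ?F] by (meson less_le_trans min_less_iff_conj)
      then have "summable (\<lambda>n. (Re (fps_nth (?P * ?F) n))\<^sup>2 * (r\<^sup>2) ^ n)"
        using r by (intro Parseval_eval_fps) (auto simp: fps_nth_shift_fps_mult_set_fps)
      then show "summable (\<lambda>n. (real_of_int (\<Sum>i=0..d. l i * char_fun A (int n - int i)))\<^sup>2 * x ^ n)"
        by (simp add: Re_u r u_def)
    qed (use x in auto)
    also have "\<dots> \<le> S * (t + (\<Sum>n. (D n)\<^sup>2 * x ^ n) / t) / 2"
      using sum_Re_coeffs_squared_le[OF realP rad(1) realF rad(2) r(1) _ t, of S] r
      by (simp add: Re_u Re_D S_def norm_eval_shift_fps_le del: of_int_sum)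
    also have "\<dots> \<le> S * (t + t) / 2"
      using DT S0 by (intro divide_right_mono mult_left_mono) auto
    finally show ?case
      by (simp add: t_def S_def mult_ac)
  qed
qed

section \<open>The numerical constant and the passage to limsups\<close>

text \<open>Rational bounds suffice: \<open>e \<ge> 1 + 1 + 1/2\<close> gives \<open>25/4\<close> on
  the right, and \<open>sqrt 2 \<le> 3/2\<close> gives 6 on the left.\<close>

lemma exp_1_squared_ge: "4 * sqrt 2 \<le> (exp 1 :: real)\<^sup>2"
proof -
  have "5 / 2 \<le> (exp 1 :: real)"
    using exp_lower_Taylor_quadratic[of 1] by simp
  then have "(5 / 2)\<^sup>2 \<le> (exp 1 :: real)\<^sup>2"
    by (rule power_mono) simp
  moreover have "sqrt 2 \<le> 3 / 2"
    by (rule real_le_lsqrt) (auto simp: power2_eq_square)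
  ultimately show ?thesis by (simp add: power2_eq_square)
qed

theorem theorem3:
  fixes A :: "nat set" and d :: nat and l :: "nat \<Rightarrow> int"
  assumes "infinite A"
    and "(\<Sum>i=0..d. \<bar>l i\<bar>) > 0"
    and "(\<Sum>i=0..d. l i) = 0"
  shows "limsup (\<lambda>n::nat. ereal (real_of_int \<bar>\<Sum>i=0..d. l i * int (rep_count A (int n - int i))\<bar>))
    \<ge> limsup (\<lambda>n::nat. ereal (sqrt 2 / ((exp 1)\<^sup>2 * real_of_int (\<Sum>i=0..d. \<bar>l i\<bar>))
                               * (real (B_count A d l n) / sqrt (real n))))"
    (is "limsup ?D \<ge> limsup ?B")
proof (rule dense_ge)
  \<comment> \<open>A bound \<open>y\<close> strictly above the left limsup holds eventually for the
    terms themselves; if that limsup is infinite, no such \<open>y\<close> exists.\<close>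
  fix y assume "limsup ?D < y"
  then have ev: "eventually (\<lambda>n. ?D n < y) sequentially"
    by (rule Limsup_lessD)
  show "limsup ?B \<le> y"
  proof (cases y)
    case PInf
    then show ?thesis by simp
  next
    case MInf
    \<comment> \<open>No real term lies below minus infinity, so \<open>ev\<close> is
      contradictory.\<close>
    then show ?thesis using ev by simp
  next
    case (real K)
    define S where "S = real_of_int (\<Sum>i=0..d. \<bar>l i\<bar>)"
    have S: "S > 0" using assms(2) by (simp only: S_def of_int_0_less_iff)
    have evK: "eventually (\<lambda>n. real_of_int \<bar>\<Sum>i=0..d. l i * int (rep_count A (int n - int i))\<bar> < K) sequentially"
      using ev by (simp add: real)
    \<comment> \<open>One absolute value strictly below \<open>K\<close> already forces
      \<open>K > 0\<close>.\<close>
    then obtain n where "real_of_int \<bar>\<Sum>i=0..d. l i * int (rep_count A (int n - int i))\<bar> < K"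
      by (meson eventually_happens sequentially_bot)
    then have K: "K > 0" by linarith
    have "eventually (\<lambda>n. real (B_count A d l n) \<le> 4 * S * K * sqrt (real n)) sequentially"
      unfolding S_def by (rule eventually_B_count_le[OF K]) (use evK in \<open>auto elim!: eventually_mono\<close>)
    then have "eventually (\<lambda>n. ?B n \<le> y) sequentially"
      using eventually_gt_at_top[of 0]
    proof eventually_elim
      case (elim n)
      have "real (B_count A d l n) / sqrt (real n) \<le> 4 * S * K"
        using elim by (simp add: field_simps)
      then have "sqrt 2 / ((exp 1)\<^sup>2 * S) * (real (B_count A d l n) / sqrt (real n))
          \<le> sqrt 2 / ((exp 1)\<^sup>2 * S) * (4 * S * K)"
        using S by (intro mult_left_mono) auto
      \<comment> \<open>The factor \<open>S\<close> cancels, leaving a constant that is at most 1 by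
        the numerical estimate.\<close>
      also have "\<dots> = 4 * sqrt 2 / (exp 1)\<^sup>2 * K"
        using S by (simp add: field_simps)
      also have "\<dots> \<le> 1 * K"
        using exp_1_squared_ge K by (intro mult_right_mono) (auto simp: field_simps)
      finally show ?case by (simp add: S_def real)
    qed
    then show ?thesis by (rule Limsup_bounded)
  qed
qed

end
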